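(* Let $A$ be a finite alphabet and let $x \in A^{\mathbb{Z}}$. Suppose that $x$ is not uniformly recurrent, that it is not true that $x$ is eventually periodic in both directions, and that $\liminf_{n\to\infty} (c_n(x) - 2n) = -\infty$. Then there exist a constant $k$ and a periodic orbit $M$ with the following property: for every $N$, there exists $m > N$ such that every $(3m+k)$-letter subword of $x$ contains an $m$-letter subword of a point in $M$.
   Context: A word over a finite set $A$ is an element of $A^n$, $n \in \mathbb{N} = \{1,2,\dots\}$; $n$ is its length. A word $w$ is a subword of a sequence $x \in A^{\mathbb{Z}}$ if there is $i$ with $x(i+j) = w(j)$ for all $1 \le j \le |w|$ (and similarly for subwords of words). The word complexity function $c_n(x)$ is the number of distinct words of length $n$ that are subwords of $x$. The sequence $x$ is uniformly recurrent if for every subword $w$ of $x$ there exists $N$ such that every $N$-letter subword of $x$ contains $w$ as a subword. A one-sided sequence $u \in A^{\mathbb{N}}$ is eventually periodic if there exist $n, N \in \mathbb{N}$ such that $u(k) = u(k+n)$ for all $k > N$; analogously for left-infinite sequences. A bi-infinite $x$ is eventually periodic in both directions if $x(0)x(1)x(2)\ldots$ and $\ldots x(-2)x(-1)$ are each eventually periodic. A sequence $p \in A^{\mathbb{Z}}$ is periodic if there is $n \neq 0$ with $p(k) = p(k+n)$ for all $k \in \mathbb{Z}$; a periodic orbit is the (finite) set $\{\sigma^n p : n \in \mathbb{Z}\}$ for a periodic $p \in A^{\mathbb{Z}}$, where $\sigma$ is the left shift. *)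

theory Defs
  imports Complex_Main "HOL-Library.Extended_Real" "HOL-Library.Sublist"
begin

(* Words have length at least 1, so they are nonempty lists.  Subwords of words are rendered by
   the library's contiguous sublist relation. *)
definition subword :: "'a list \<Rightarrow> (int \<Rightarrow> 'a) \<Rightarrow> bool" where
  "subword w x \<longleftrightarrow> w \<noteq> [] \<and> (\<exists>i. \<forall>j<length w. x (i + int j) = w ! j)"

definition complexity :: "(int \<Rightarrow> 'a) \<Rightarrow> nat \<Rightarrow> nat" where
  "complexity x n = card {w. subword w x \<and> length w = n}"

(* N \<ge> 1 matters: there is no subword of length 0, so N = 0 would be vacuous. *)
definition uniformly_recurrent :: "(int \<Rightarrow> 'a) \<Rightarrow> bool" where
  "uniformly_recurrent x \<longleftrightarrow>
     (\<forall>w. subword w x \<longrightarrow> (\<exists>N\<ge>1. \<forall>v. subword v x \<and> length v = N \<longrightarrow> sublist w v))"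

definition eventually_periodic :: "(nat \<Rightarrow> 'a) \<Rightarrow> bool" where
  "eventually_periodic u \<longleftrightarrow> (\<exists>n\<ge>1. \<exists>N. \<forall>k>N. u k = u (k + n))"

(* The left-infinite half ... x(-2) x(-1) is read from right to left. *)
definition eventually_periodic_both :: "(int \<Rightarrow> 'a) \<Rightarrow> bool" where
  "eventually_periodic_both x \<longleftrightarrow>
     eventually_periodic (\<lambda>k. x (int k)) \<and> eventually_periodic (\<lambda>k. x (- 1 - int k))"

definition periodic :: "(int \<Rightarrow> 'a) \<Rightarrow> bool" where
  "periodic p \<longleftrightarrow> (\<exists>n. n \<noteq> 0 \<and> (\<forall>k. p k = p (k + n)))"

definition left_shift :: "(int \<Rightarrow> 'a) \<Rightarrow> int \<Rightarrow> 'a" where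
  "left_shift x = (\<lambda>k. x (k + 1))"

(* The integer powers of left_shift, in closed form; see the lemmas below. *)
definition shift_pow :: "int \<Rightarrow> (int \<Rightarrow> 'a) \<Rightarrow> int \<Rightarrow> 'a" where
  "shift_pow n x = (\<lambda>k. x (k + n))"

lemma shift_pow_nat: "shift_pow (int n) x = (left_shift ^^ n) x"
proof (induction n)
  case 0
  show ?case by (simp add: shift_pow_def fun_eq_iff)
next
  case (Suc n)
  have "shift_pow (int (Suc n)) x = left_shift (shift_pow (int n) x)"
    by (simp add: shift_pow_def left_shift_def fun_eq_iff algebra_simps)
  with Suc show ?case by simp
qed

lemma shift_pow_uminus: "shift_pow (- n) (shift_pow n x) = x"
  by (simp add: shift_pow_def)

definition periodic_orbit :: "'a set \<Rightarrow> (int \<Rightarrow> 'a) set \<Rightarrow> bool" where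
  "periodic_orbit A M \<longleftrightarrow>
     (\<exists>p. range p \<subseteq> A \<and> periodic p \<and> M = {shift_pow n p |n. True})"

end

theory Submission
  imports Defs
begin

text \<open>
  Failure of uniform recurrence yields a subword \<open>w\<close> of \<open>x\<close> and arbitrarily long subwords of \<open>x\<close>
  that avoid \<open>w\<close>. Sliding a window of length \<open>n\<close> over an occurrence of \<open>w\<close> that borders a long
  \<open>w\<close>-free stretch produces \<open>n - length w + 1\<close> distinct words that contain \<open>w\<close>. When the complexity
  at \<open>n\<close> is at most \<open>2 * n - length w\<close>, fewer than \<open>n\<close> words of length \<open>n\<close> are left for the
  words that avoid \<open>w\<close>. An infinite sequence with all its factors among these words exists by
  compactness; by the theorem of Morse and Hedlund it is eventually periodic, and its period gives
  a periodic \<open>p\<close> all of whose subwords are subwords of \<open>x\<close>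
  (\<open>periodic_sequence_in_orbit_closure\<close>).

  Since the complexity minus \<open>2 * n\<close> is unbounded below, there are infinitely many \<open>n\<close> at which the
  complexity \<open>c n\<close> is at most \<open>2 * n\<close> and grows by at most one
  (\<open>slow_growth_frequently\<close>). For such \<open>n\<close>, beyond the period of \<open>p\<close>, at most one
  word of length \<open>n\<close> has several right extensions in \<open>x\<close>. Up to reversal, \<open>x\<close> is not eventually periodic to the right; then \<open>x\<close> leaves
  the language of \<open>p\<close> somewhere, and the word at which it does so is that single branching word.
  Outside the language of \<open>p\<close> every word therefore determines the next letter. If \<open>c n + 1\<close>
  consecutive windows of length \<open>n\<close> stayed outside, two of them would agree and \<open>x\<close> would cycle
  between them for ever, contrary to the choice of direction
  (\<open>periodic_words_syndetic_right\<close>). These windows cover \<open>c n + n\<close> letters, which is at most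
  \<open>3 * n\<close>, so the constant \<open>k\<close> can be taken to be \<open>0\<close> and \<open>M\<close> to be the orbit of \<open>p\<close>.
\<close>

section \<open>Windows of a bi-infinite sequence\<close>

definition window :: "(int \<Rightarrow> 'a) \<Rightarrow> int \<Rightarrow> nat \<Rightarrow> 'a list" where
  "window x i n = map (\<lambda>j. x (i + int j)) [0..<n]"

lemma length_window [simp]: "length (window x i n) = n"
  by (simp add: window_def)

lemma nth_window [simp]: "j < n \<Longrightarrow> window x i n ! j = x (i + int j)"
  by (simp add: window_def)

lemma window_0 [simp]: "window x i 0 = []"
  by (simp add: window_def)

lemma window_eq_Nil_iff [simp]: "window x i n = [] \<longleftrightarrow> n = 0"
  by (simp add: window_def)

lemma window_add: "window x i (m + n) = window x i m @ window x (i + int m) n"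
  by (rule nth_equalityI) (auto simp: nth_append)

lemma window_eq_iff:
  "window x i n = window y j n \<longleftrightarrow> (\<forall>k<n. x (i + int k) = y (j + int k))"
  by (auto simp: list_eq_iff_nth_eq)

lemma take_window [simp]: "m \<le> n \<Longrightarrow> take m (window x i n) = window x i m"
  by (rule nth_equalityI) auto

lemma window_eq_shorter:
  assumes "window x i n = window y j n" "a + m \<le> n"
  shows "window x (i + int a) m = window y (j + int a) m"
  unfolding window_eq_iff
proof (intro allI impI)
  fix k assume "k < m"
  then have "a + k < n" using assms(2) by simp
  then have "x (i + int (a + k)) = y (j + int (a + k))"
    using assms(1) unfolding window_eq_iff by blast
  then show "x (i + int a + int k) = y (j + int a + int k)"
    by (simp add: add.assoc)
qed

lemma subword_iff_window: "subword w x \<longleftrightarrow> w \<noteq> [] \<and> (\<exists>i. w = window x i (length w))"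
proof -
  have "w = window x i (length w) \<longleftrightarrow> (\<forall>j<length w. x (i + int j) = w ! j)" for i
    by (subst list_eq_iff_nth_eq) auto
  then show ?thesis by (simp add: subword_def)
qed

lemma subword_window [simp]: "subword (window x i n) x \<longleftrightarrow> n > 0"
  by (auto simp: subword_iff_window)

lemma sublist_window_iff:
  "sublist w (window x i n) \<longleftrightarrow>
     (\<exists>k. k + length w \<le> n \<and> window x (i + int k) (length w) = w)"
proof
  assume "sublist w (window x i n)"
  then obtain ps ss where eq: "window x i n = ps @ w @ ss" unfolding sublist_def by blast
  then have len: "n = length ps + (length w + length ss)"
    by (metis length_append length_window)
  then have "window x i n = window x i (length ps) @ window x (i + int (length ps)) (length w)
      @ window x (i + int (length ps) + int (length w)) (length ss)"
    by (simp only: window_add)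
  with eq have "window x (i + int (length ps)) (length w) = w"
    by simp
  with len show "\<exists>k. k + length w \<le> n \<and> window x (i + int k) (length w) = w"
    by (intro exI[of _ "length ps"]) simp
next
  assume "\<exists>k. k + length w \<le> n \<and> window x (i + int k) (length w) = w"
  then obtain k where k: "k + length w \<le> n" and w: "window x (i + int k) (length w) = w"
    by blast
  obtain r where "n = k + (length w + r)" using k le_Suc_ex by (metis add.assoc)
  then have "window x i n = window x i k @ w @ window x (i + int k + int (length w)) r"
    by (simp only: window_add w)
  then show "sublist w (window x i n)" unfolding sublist_def by blast
qed

lemma finite_windows:
  assumes "finite (range x)"
  shows "finite (range (\<lambda>i. window x i n))"
proof (rule finite_subset)
  show "range (\<lambda>i. window x i n) \<subseteq> {xs. set xs \<subseteq> range x \<and> length xs = n}"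
    by (auto simp: window_def)
qed (use assms finite_lists_length_eq in blast)

lemma complexity_eq_card_windows:
  assumes "n > 0"
  shows "complexity x n = card (range (\<lambda>i. window x i n))"
proof -
  have "{w. subword w x \<and> length w = n} = range (\<lambda>i. window x i n)"
    using assms by (auto simp: subword_iff_window)
  then show ?thesis by (simp add: complexity_def)
qed

lemma image_take_windows:
  "take n ` (\<lambda>i. window x i (Suc n)) ` I = (\<lambda>i. window x i n) ` I"
  by (simp add: image_image)

lemma complexity_mono_Suc:
  assumes "finite (range x)"
  shows "complexity x n \<le> complexity x (Suc n)"
proof (cases "n = 0")
  case True
  then have "{w. subword w x \<and> length w = n} = {}" by (auto simp: subword_def)
  then have "complexity x n = 0" by (simp only: complexity_def card.empty)
  then show ?thesis by simp
next
  case False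
  then show ?thesis
    using card_image_le[OF finite_windows[OF assms, of "Suc n"], of "take n"]
    by (simp add: complexity_eq_card_windows image_take_windows)
qed

section \<open>Periodicity from unique continuation\<close>

text \<open>
  If the words of length \<open>n\<close> seen between two equal windows determine the letter that follows them,
  then the sequence retraces the loop between these two windows for ever. The continuation has to be
  unique only along the half-line that starts at \<open>s\<close>, so the same statement serves one-sided
  sequences.
\<close>

lemma repeated_window_imp_periodic:
  fixes d n :: nat
  assumes d: "d > 0"
    and rep: "window x (s + int d) n = window x s n"
    and det: "\<And>r t::nat. r < d \<Longrightarrow> window x (s + int t) n = window x (s + int r) n \<Longrightarrow>
                window x (s + int t) (Suc n) = window x (s + int r) (Suc n)"
  shows "x (s + int t) = x (s + int (t mod d))"
proof -
  have win: "window x (s + int t) n = window x (s + int (t mod d)) n" for t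
  proof (induction t)
    case (Suc t)
    have "window x (s + int t) (Suc n) = window x (s + int (t mod d)) (Suc n)"
      using det[OF _ Suc] d by simp
    from window_eq_shorter[OF this, of 1 n]
    have "window x (s + int (Suc t)) n = window x (s + int (Suc (t mod d))) n"
      by (simp add: ac_simps)
    also have "\<dots> = window x (s + int (Suc t mod d)) n"
      using rep by (simp add: mod_Suc del: of_nat_Suc)
    finally show ?case .
  qed simp
  have "window x (s + int t) (Suc n) = window x (s + int (t mod d)) (Suc n)"
    using det[OF _ win] d by simp
  then show ?thesis by (auto simp: window_eq_iff)
qed

lemma eventually_periodic_half_lineI:
  assumes "d > 0" and "\<And>t::nat. x (s + int (t + d)) = x (s + int t)"
  shows "eventually_periodic (\<lambda>k. x (int k))"
  unfolding eventually_periodic_def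
proof (intro exI conjI allI impI)
  show "1 \<le> d" using assms(1) by simp
next
  fix k assume "nat s < k"
  then have "int k = s + int (nat (int k - s))" "int (k + d) = s + int (nat (int k - s) + d)"
    by auto
  then show "x (int k) = x (int (k + d))" using assms(2) by metis
qed

text \<open>
  The counts of factors of the right half of \<open>y\<close> start at \<open>1\<close> for length \<open>0\<close>, so they cannot
  increase at each of the first \<open>n\<close> steps when the count at \<open>n\<close> is at most \<open>n\<close>. At a length where
  the count does not increase, all continuations are unique.
\<close>

lemma Morse_Hedlund_right:
  assumes fin: "finite (range y)"
    and card_le: "card (range (\<lambda>i::nat. window y (int i) n)) \<le> n"
  obtains s d :: nat where "d > 0" "\<And>t. y (int s + int t) = y (int s + int (t mod d))"
proof -
  define W where "W l = range (\<lambda>i::nat. window y (int i) l)" for l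
  have finW: "finite (W l)" for l
    by (rule finite_subset[OF _ finite_windows[OF fin, of l]]) (auto simp: W_def)
  have W0: "card (W 0) = 1" by (simp add: W_def)
  have take_W: "take l ` W (Suc l) = W l" for l
    by (simp add: W_def image_take_windows image_image)
  have "\<exists>l. card (W (Suc l)) \<le> card (W l)"
  proof (rule ccontr)
    assume "\<nexists>l. card (W (Suc l)) \<le> card (W l)"
    then have grow: "card (W l) < card (W (Suc l))" for l by (meson not_le)
    have "l < card (W l)" for l
    proof (induction l)
      case (Suc l)
      then show ?case using grow[of l] by linarith
    qed (simp add: W0)
    from this[of n] show False using card_le by (simp add: W_def)
  qed
  then obtain l where l: "card (W (Suc l)) \<le> card (W l)" by blast
  have inj: "inj_on (take l) (W (Suc l))"
    using l card_image_le[OF finW[of "Suc l"], of "take l"]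
    by (intro eq_card_imp_inj_on[OF finW]) (simp add: take_W)
  have "\<not> inj (\<lambda>i::nat. window y (int i) l)"
    using finW[of l] range_inj_infinite unfolding W_def by blast
  then obtain i j :: nat where "i < j" "window y (int j) l = window y (int i) l"
    unfolding inj_def by (metis linorder_neqE_nat)
  then have rep: "window y (int i + int (j - i)) l = window y (int i) l" "j - i > 0" by auto
  have "y (int i + int t) = y (int i + int (t mod (j - i)))" for t
  proof (rule repeated_window_imp_periodic[OF rep(2,1)])
    fix r t :: nat
    assume "window y (int i + int t) l = window y (int i + int r) l"
    then have "take l (window y (int (i + t)) (Suc l)) = take l (window y (int (i + r)) (Suc l))"
      by simp
    then have "window y (int (i + t)) (Suc l) = window y (int (i + r)) (Suc l)"
      by (rule inj_onD[OF inj]) (auto simp only: W_def)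
    then show "window y (int i + int t) (Suc l) = window y (int i + int r) (Suc l)"
      by simp
  qed
  with rep(2) show thesis by (rule that)
qed

section \<open>A periodic sequence in the orbit closure\<close>

text \<open>
  This is Koenig's lemma for the tree of words in a factorial language \<open>F\<close>: a word with arbitrarily
  long continuations in \<open>F\<close> has a one-letter extension with the same property. The branch is
  indexed by the integers only to be a sequence of the type used elsewhere; its values at negative
  positions carry no information.
\<close>

lemma infinite_branch:
  assumes fin: "finite A"
    and letters: "\<And>v. F v \<Longrightarrow> set v \<subseteq> A"
    and factors: "\<And>u v. F v \<Longrightarrow> sublist u v \<Longrightarrow> F u"
    and long: "\<And>N. \<exists>v. F v \<and> N \<le> length v"
  obtains y :: "int \<Rightarrow> 'a" where "\<And>(i::nat) n. F (window y (int i) n)"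
proof -
  define P where "P u \<longleftrightarrow> (\<forall>N. \<exists>v. F (u @ v) \<and> N \<le> length v)" for u
  have ext: "\<exists>a. P (u @ [a])" if "P u" for u
  proof (rule ccontr)
    assume "\<nexists>a. P (u @ [a])"
    then obtain B where B: "\<And>a v. F ((u @ [a]) @ v) \<Longrightarrow> length v < B a"
      unfolding P_def by (metis not_le)
    \<comment> \<open>A continuation longer than the sum of the bounds for the single letters exceeds
      the bound that belongs to its own first letter.\<close>
    obtain v where v: "F (u @ v)" "Suc (\<Sum>a\<in>A. B a) \<le> length v"
      using \<open>P u\<close> unfolding P_def by blast
    then obtain a v' where v': "v = a # v'" by (cases v) auto
    have "a \<in> A" using letters[OF v(1)] v' by auto
    then have "B a \<le> (\<Sum>a\<in>A. B a)" using fin by (intro member_le_sum) auto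
    moreover have "length v' < B a" using B[of a v'] v(1) v' by simp
    ultimately show False using v(2) v' by simp
  qed
  have P0: "P []" using long by (simp add: P_def)
  have "\<exists>f. \<forall>k. (P (f k) \<and> length (f k) = k) \<and> (\<exists>a. f (Suc k) = f k @ [a])"
  proof (rule dependent_nat_choice)
    show "\<exists>u. P u \<and> length u = 0" using P0 by simp
  next
    fix u and k :: nat assume "P u \<and> length u = k"
    with ext[of u] show "\<exists>u'. (P u' \<and> length u' = Suc k) \<and> (\<exists>a. u' = u @ [a])" by auto
  qed
  then obtain f where f0: "\<And>k::nat. P (f k) \<and> length (f k) = k"
    and f1: "\<And>k. \<exists>a. f (Suc k) = f k @ [a]" by blast
  define y where "y k = last (f (Suc (nat k)))" for k
  have prefix: "window y 0 k = f k" for k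
  proof (induction k)
    case 0
    then show ?case using f0[of 0] by simp
  next
    case (Suc k)
    obtain a where a: "f (Suc k) = f k @ [a]" using f1 by blast
    have "window y 0 (Suc k) = window y 0 k @ [y (int k)]" by (simp add: window_def)
    moreover have "y (int k) = a" by (simp add: y_def a)
    ultimately show ?case by (simp only: Suc a)
  qed
  have "F (window y (int i) n)" for i n :: nat
  proof -
    have "F (f (i + n))"
      using f0[of "i + n"] factors unfolding P_def by (meson sublist_append_rightI)
    then have "F (window y 0 i @ window y (int i) n)"
      by (simp add: window_add flip: prefix)
    then show ?thesis using factors by blast
  qed
  then show thesis by (rule that)
qed

text \<open>
  All windows of length \<open>n\<close> that cover the occurrence of \<open>w\<close> at \<open>j\<close> are considered. If those starting
  at \<open>s < s'\<close> were equal, the occurrence at \<open>j\<close>, seen from the first window and transported to the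
  second, would give one to the right of \<open>j\<close>; transported from the second window to the first, it
  would give one to the left. One of the two is excluded.
\<close>

lemma inj_on_windows_around_extreme_occurrence:
  assumes occ: "window x j l = w" and "l \<le> n"
    and extreme: "(\<forall>k. j < k \<and> k \<le> j + int (n - l) \<longrightarrow> window x k l \<noteq> w) \<or>
                  (\<forall>k. j - int (n - l) \<le> k \<and> k < j \<longrightarrow> window x k l \<noteq> w)"
  shows "inj_on (\<lambda>s. window x s n) {j - int (n - l) .. j}"
proof (rule linorder_inj_onI')
  fix s s' assume s: "s \<in> {j - int (n - l)..j}" "s' \<in> {j - int (n - l)..j}" "s < s'"
  show "window x s n \<noteq> window x s' n"
  proof
    assume eq: "window x s n = window x s' n"
    from window_eq_shorter[OF eq, of "nat (j - s)" l]
    have "window x (s' + (j - s)) l = w" using s occ \<open>l \<le> n\<close> by auto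
    moreover from window_eq_shorter[OF eq, of "nat (j - s')" l]
    have "window x (s + (j - s')) l = w" using s occ \<open>l \<le> n\<close> by auto
    moreover have "j < s' + (j - s)" "s' + (j - s) \<le> j + int (n - l)"
        "j - int (n - l) \<le> s + (j - s')" "s + (j - s') < j"
      using s by auto
    ultimately show False using extreme by blast
  qed
qed

text \<open>
  Among the occurrences on one side of a free interval, the one closest to the interval has no
  other occurrence between itself and the far end of the interval.
\<close>

lemma extreme_occurrence_exists:
  fixes i j :: int and m :: nat
  assumes "Q j" and free: "\<And>k. i \<le> k \<Longrightarrow> k \<le> i + int m \<Longrightarrow> \<not> Q k"
  obtains j' where "Q j'"
    "(\<forall>k. j' < k \<and> k \<le> j' + int m \<longrightarrow> \<not> Q k) \<or> (\<forall>k. j' - int m \<le> k \<and> k < j' \<longrightarrow> \<not> Q k)"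
proof (cases "j < i")
  case True
  define S where "S = {j..i} \<inter> Collect Q"
  have S: "finite S" "j \<in> S" using True \<open>Q j\<close> by (auto simp: S_def)
  then have "Max S \<in> S" using Max_in by blast
  then have "Q (Max S)" "Max S \<le> i" "j \<le> Max S" by (auto simp: S_def)
  moreover have "\<not> Q k" if "Max S < k" "k \<le> Max S + int m" for k
  proof (cases "k \<le> i")
    case True
    then have "k \<in> S \<longleftrightarrow> Q k" using that \<open>j \<le> Max S\<close> by (simp add: S_def)
    then show ?thesis using that S Max_ge[of S k] by linarith
  next
    case False
    then show ?thesis using free[of k] that \<open>Max S \<le> i\<close> by auto
  qed
  ultimately show thesis using that by blast
next
  case False
  define S where "S = {i..j} \<inter> Collect Q"
  have S: "finite S" "j \<in> S" using False \<open>Q j\<close> by (auto simp: S_def)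
  then have "Min S \<in> S" using Min_in by blast
  then have Min: "Q (Min S)" "i \<le> Min S" "Min S \<le> j" by (auto simp: S_def)
  then have "i + int m < Min S" using free[of "Min S"] by force
  moreover have "\<not> Q k" if "i \<le> k" "k < Min S" for k
  proof -
    have "k \<in> S \<longleftrightarrow> Q k" using that Min(3) by (simp add: S_def)
    then show ?thesis using that S Min_le[of S k] by linarith
  qed
  ultimately show thesis using that[of "Min S"] Min by auto
qed

text \<open>
  The windows that cover an occurrence of \<open>w\<close> next to a \<open>w\<close>-free stretch supply
  \<open>n - length w + 1\<close> different words that contain \<open>w\<close>.
\<close>

lemma card_avoiding_words_le:
  assumes fin: "finite (range x)" and w: "subword w x" and n: "length w \<le> n"
    and free: "\<exists>v. subword v x \<and> length v = n \<and> \<not> sublist w v"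
  shows "card {v \<in> range (\<lambda>i. window x i n). \<not> sublist w v} + (n - length w + 1) \<le> complexity x n"
proof -
  define R where "R = range (\<lambda>i. window x i n)"
  have n0: "n > 0" using w n by (cases w) (auto simp: subword_def)
  obtain j where j: "window x j (length w) = w" using w by (metis subword_iff_window)
  obtain i where i: "\<not> sublist w (window x i n)" using free by (metis subword_iff_window)
  have nofree: "window x k (length w) \<noteq> w" if "i \<le> k" "k \<le> i + int (n - length w)" for k
  proof
    assume "window x k (length w) = w"
    then have "sublist w (window x i n)"
      unfolding sublist_window_iff using that n by (intro exI[of _ "nat (k - i)"]) auto
    with i show False ..
  qed
  obtain j' where j': "window x j' (length w) = w"
    "(\<forall>k. j' < k \<and> k \<le> j' + int (n - length w) \<longrightarrow> window x k (length w) \<noteq> w) \<or>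
     (\<forall>k. j' - int (n - length w) \<le> k \<and> k < j' \<longrightarrow> window x k (length w) \<noteq> w)"
    by (rule extreme_occurrence_exists[of "\<lambda>k. window x k (length w) = w", OF j nofree])
  define I where "I = {j' - int (n - length w) .. j'}"
  define C where "C = (\<lambda>s. window x s n) ` I"
  have "card C = n - length w + 1"
    unfolding C_def I_def
    by (subst card_image[OF inj_on_windows_around_extreme_occurrence[OF j'(1) n j'(2)]]) simp
  moreover have C_occ: "sublist w v" if v: "v \<in> C" for v
  proof -
    obtain s where s: "v = window x s n" "s \<in> I" using v by (auto simp: C_def)
    have "nat (j' - s) + length w \<le> n" "s + int (nat (j' - s)) = j'"
      using s(2) n by (auto simp: I_def)
    then show ?thesis
      unfolding s(1) sublist_window_iff using j'(1) by metis
  qed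
  moreover have "finite R" "C \<subseteq> R"
    using finite_windows[OF fin, of n] by (auto simp: R_def C_def)
  then have "card ({v \<in> R. \<not> sublist w v} \<union> C) \<le> card R"
      and "card ({v \<in> R. \<not> sublist w v} \<union> C) = card {v \<in> R. \<not> sublist w v} + card C"
    using C_occ by (auto intro!: card_mono card_Un_disjoint dest: finite_subset)
  ultimately show ?thesis using n0 by (simp add: complexity_eq_card_windows R_def)
qed

text \<open>
  The second inequality on \<open>n\<close> leaves at most \<open>n\<close> words of length \<open>n\<close> that avoid \<open>w\<close>, which is the
  Morse-Hedlund bound for a sequence \<open>y\<close> built from \<open>w\<close>-free subwords of \<open>x\<close>. The periodic tail
  of \<open>y\<close> extends to a bi-infinite \<open>p\<close>, and each window of \<open>p\<close> already occurs in this tail.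
\<close>

lemma periodic_sequence_in_orbit_closure:
  assumes fin: "finite (range x)"
    and w: "subword w x"
    and free: "\<And>N. N \<ge> 1 \<Longrightarrow> \<exists>v. subword v x \<and> length v = N \<and> \<not> sublist w v"
    and n: "length w \<le> n" "complexity x n + length w \<le> 2 * n"
  obtains p and d :: nat where "d > 0" "\<And>k. p (k + int d) = p k" "\<And>v. subword v p \<Longrightarrow> subword v x"
proof -
  define F where "F v \<longleftrightarrow> (\<exists>i. v = window x i (length v)) \<and> \<not> sublist w v" for v
  have w0: "w \<noteq> []" using w by (simp add: subword_def)
  then have n1: "n \<ge> 1" using n(1) by (cases w) auto
  obtain y where y: "\<And>(i::nat) m. F (window y (int i) m)"
  proof (rule infinite_branch[of "range x" F])
    show "set v \<subseteq> range x" if "F v" for v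
      using that unfolding F_def window_def by (metis (lifting) image_subset_iff list.set_map rangeI)
    show "F u" if v: "F v" and u: "sublist u v" for u v
    proof -
      obtain i where "v = window x i (length v)" using v by (auto simp: F_def)
      then obtain k where "window x (i + int k) (length u) = u"
        using u by (metis sublist_window_iff)
      then have "\<exists>i. u = window x i (length u)" by metis
      moreover have "\<not> sublist w u" using v u sublist_order.order_trans by (auto simp: F_def)
      ultimately show ?thesis by (simp add: F_def)
    qed
    show "\<exists>v. F v \<and> N \<le> length v" for N
      using free[of "Suc N"] unfolding F_def subword_iff_window by auto
  qed (use fin in auto)
  have yx: "\<exists>j. window y (int i) m = window x j m" for i m
    using y[of i m] by (auto simp: F_def)
  \<comment> \<open>The left half of \<open>y\<close> is replaced by a constant to make the range finite.\<close>
  define y' where "y' k = y (int (nat k))" for k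
  have y'y: "window y' (int i) m = window y (int i) m" for i m
    by (simp add: window_eq_iff y'_def nat_add_distrib)
  have "range y' \<subseteq> range x"
  proof
    fix a assume "a \<in> range y'"
    then obtain i where i: "a = y (int i)" unfolding y'_def by blast
    obtain j where "window y (int i) 1 = window x j 1" using yx by blast
    then show "a \<in> range x" by (auto simp: window_eq_iff i)
  qed
  then have fin': "finite (range y')" using fin finite_subset by blast
  have "card (range (\<lambda>i::nat. window y' (int i) n))
      \<le> card {v \<in> range (\<lambda>i. window x i n). \<not> sublist w v}"
  proof (rule card_mono)
    show "range (\<lambda>i::nat. window y' (int i) n) \<subseteq> {v \<in> range (\<lambda>i. window x i n). \<not> sublist w v}"
      using y[of _ n] by (auto simp: F_def y'y)
  qed (use finite_windows[OF fin, of n] in simp)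
  also have "\<dots> \<le> n"
    using card_avoiding_words_le[OF fin w n(1) free[OF n1]] n by linarith
  finally obtain s d :: nat where d: "d > 0"
    and per: "\<And>t. y' (int s + int t) = y' (int s + int (t mod d))"
    using Morse_Hedlund_right[OF fin'] by metis
  define p where "p k = y' (int s + k mod int d)" for k
  have p_window: "window p i m = window y (int (s + nat (i mod int d))) m" for i m
    unfolding y'y[symmetric] window_eq_iff
  proof (intro allI impI)
    fix k
    have "int ((nat (i mod int d) + k) mod d) = (i + int k) mod int d"
      using d by (simp add: zmod_int mod_add_left_eq)
    then show "p (i + int k) = y' (int (s + nat (i mod int d)) + int k)"
      using per[of "nat (i mod int d) + k"] by (simp add: p_def add.assoc)
  qed
  show thesis
  proof (rule that[OF d])
    show "p (k + int d) = p k" for k by (simp add: p_def)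
    show "subword v x" if "subword v p" for v
      using that yx unfolding subword_iff_window by (metis p_window)
  qed
qed

section \<open>Lengths at which the complexity grows slowly\<close>

lemma small_deficit_frequently:
  assumes "liminf (\<lambda>n. ereal (real (c n) - 2 * real n)) = - \<infinity>"
  shows "\<exists>n\<ge>N. int (c n) - 2 * int n < B"
proof (rule ccontr)
  assume "\<not> ?thesis"
  then have "\<And>n. n \<ge> N \<Longrightarrow> B \<le> int (c n) - 2 * int n" by force
  then have "eventually (\<lambda>n. ereal (real_of_int B) \<le> ereal (real (c n) - 2 * real n)) sequentially"
    unfolding eventually_sequentially
    by (metis (mono_tags) ereal_less_eq(3) of_int_diff of_int_le_iff of_int_mult of_int_numeral of_int_of_nat_eq)
  then have "ereal (real_of_int B) \<le> liminf (\<lambda>n. ereal (real (c n) - 2 * real n))"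
    by (rule Liminf_bounded)
  with assms show False by simp
qed

text \<open>
  Let \<open>D n = c n - 2 * n\<close>. As \<open>c\<close> is monotone, \<open>D\<close> drops by at most \<open>2\<close> in one step. If from \<open>N\<close> on
  \<open>D\<close> never decreased at a nonpositive value, it could only fall from a positive value, hence
  never below \<open>min (-2) (D N)\<close>.
\<close>

lemma slow_growth_frequently:
  fixes c :: "nat \<Rightarrow> nat"
  assumes mono: "\<And>n. c n \<le> c (Suc n)"
    and lim: "liminf (\<lambda>n. ereal (real (c n) - 2 * real n)) = - \<infinity>"
  shows "\<exists>n\<ge>N. c n \<le> 2 * n \<and> c (Suc n) \<le> c n + 1"
proof (rule ccontr)
  assume no: "\<not> ?thesis"
  define D where "D n = int (c n) - 2 * int n" for n
  have D_mono: "D n \<le> D (Suc n)" if "N \<le> n" "D n \<le> 0" for n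
    using no that by (force simp: D_def)
  have "min (-2) (D N) \<le> D n" if "N \<le> n" for n
    using that
  proof (induction n rule: dec_induct)
    case (step n)
    show ?case
    proof (cases "D n \<le> 0")
      case True
      then show ?thesis using step D_mono[of n] by linarith
    next
      case False
      then show ?thesis using mono[of n] by (simp add: D_def)
    qed
  qed simp
  then show False
    using small_deficit_frequently[OF lim, of N "min (-2) (D N)"] by (force simp: D_def)
qed

section \<open>The unique branching word lies on the periodic orbit\<close>

text \<open>
  For \<open>f\<close> the truncation of the words of length \<open>n + 1\<close> to length \<open>n\<close>, the elements \<open>a\<close> and \<open>b\<close> are two
  right extensions of one word. When complexity grows by at most one, this collision is the only
  one.
\<close>

lemma inj_on_remove_collision:
  assumes "finite S" "card S \<le> card (f ` S) + 1" "a \<in> S" "b \<in> S" "a \<noteq> b" "f a = f b"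
  shows "inj_on f (S - {a})"
proof (rule eq_card_imp_inj_on)
  have "f ` S = f ` (S - {a})" using assms(3-6) by blast
  then show "card (f ` (S - {a})) = card (S - {a})"
    using assms(1-3) card_image_le[of "S - {a}" f] by simp
qed (use assms in simp)

text \<open>
  The words of \<open>p\<close> extend inside the language of \<open>p\<close>, and one of them also extends in \<open>x\<close> to leave it.
  That word uses up the only branching that the growth condition permits, so \<open>x\<close> moves
  deterministically while its windows lie outside the language of \<open>p\<close>, and a repetition there would
  make \<open>x\<close> eventually periodic.
\<close>

lemma periodic_words_syndetic_right:
  fixes d n :: nat
  assumes fin: "finite (range x)"
    and aper: "\<not> eventually_periodic (\<lambda>k. x (int k))"
    and per: "\<And>k. p (k + int d) = p k" and d: "0 < d" "d < n"
    and px: "\<And>v. subword v p \<Longrightarrow> subword v x"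
    and slow: "complexity x (Suc n) \<le> complexity x n + 1"
    and v: "subword v x" "complexity x n + n \<le> length v"
  shows "\<exists>w. length w = n \<and> sublist w v \<and> subword w p"
proof (rule ccontr)
  assume no: "\<not> ?thesis"
  define S where "S m = range (\<lambda>i. window x i m)" for m
  define L where "L = range (\<lambda>i. window p i n)"
  have n0: "n > 0" using d by simp
  have finS: "finite (S m)" for m using finite_windows[OF fin] by (simp add: S_def)
  have pS: "window p i m \<in> S m" if "m > 0" for i m
    using px[of "window p i m"] that by (auto simp: subword_iff_window S_def)
  \<comment> \<open>A half-line of windows in the language of \<open>p\<close> has period \<open>d\<close>, because a window of length
    \<open>n > d\<close> shows both letters at distance \<open>d\<close>.\<close>
  have "\<exists>j. window x j n \<in> L \<and> window x (j + 1) n \<notin> L"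
  proof (rule ccontr)
    assume stay: "\<not> ?thesis"
    obtain i where "window p 0 n = window x i n"
      using pS[OF n0, of 0] by (auto simp: S_def)
    then have i: "window x i n \<in> L" unfolding L_def by (metis rangeI)
    have inL: "window x (i + int t) n \<in> L" for t
    proof (induction t)
      case (Suc t)
      then show ?case using stay by (metis add.assoc of_nat_Suc add.commute)
    qed (use i in simp)
    have "x (i + int (t + d)) = x (i + int t)" for t
    proof -
      obtain j where "window x (i + int t) n = window p j n" using inL[of t] by (auto simp: L_def)
      then have eq: "k < n \<Longrightarrow> x (i + int t + int k) = p (j + int k)" for k
        by (simp add: window_eq_iff)
      show ?thesis using eq[of 0] eq[of d] d per[of j] by (simp add: add.assoc)
    qed
    then show False using aper eventually_periodic_half_lineI[OF d(1)] by blast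
  qed
  then obtain j j' where exit: "window x j n = window p j' n" "window x (j + 1) n \<notin> L"
    by (auto simp: L_def)
  have "window x j (Suc n) \<noteq> window p j' (Suc n)"
    using exit(2) window_eq_shorter[of x j "Suc n" p j' 1 n] by (auto simp: L_def)
  then have inj: "inj_on (take n) (S (Suc n) - {window x j (Suc n)})"
    using slow n0 exit(1)
    by (intro inj_on_remove_collision[OF finS, where b = "window p j' (Suc n)"] pS)
      (auto simp: complexity_eq_card_windows image_take_windows S_def)
  have det: "window x t (Suc n) = window x s (Suc n)"
    if "window x t n = window x s n" "window x s n \<notin> L" for s t
  proof -
    have "window x s (Suc n) \<noteq> window x j (Suc n)" "window x t (Suc n) \<noteq> window x j (Suc n)"
      using that exit(1) by (metis L_def le_SucI order_refl rangeI take_window)+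
    then show ?thesis
      using inj_onD[OF inj, of "window x t (Suc n)" "window x s (Suc n)"] that(1)
      by (auto simp: S_def)
  qed
  obtain a where a: "v = window x a (length v)" using v(1) by (auto simp: subword_iff_window)
  have out: "window x (a + int r) n \<notin> L" if "r \<le> complexity x n" for r
  proof
    assume "window x (a + int r) n \<in> L"
    then have "subword (window x (a + int r) n) p" using n0 by (auto simp: L_def)
    moreover have "sublist (window x (a + int r) n) v"
      using that v(2) by (subst a) (auto simp: sublist_window_iff intro!: exI[of _ r])
    ultimately show False using no by auto
  qed
  have "\<not> inj_on (\<lambda>r::nat. window x (a + int r) n) {..complexity x n}"
  proof
    assume "inj_on (\<lambda>r::nat. window x (a + int r) n) {..complexity x n}"
    then have "card {..complexity x n} \<le> card (S n)"
      by (rule card_inj_on_le) (auto simp: S_def finS[unfolded S_def])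
    then show False using n0 by (simp add: S_def complexity_eq_card_windows)
  qed
  then obtain r r' where r: "r < r'" "r' \<le> complexity x n"
    "window x (a + int r') n = window x (a + int r) n"
    by (metis (no_types, lifting) atMost_iff inj_onI linorder_neqE_nat)
  define s e where "s = a + int r" and "e = r' - r"
  have e: "e > 0" "window x (s + int e) n = window x s n" using r by (auto simp: s_def e_def)
  have x_mod: "x (s + int t) = x (s + int (t mod e))" for t
  proof (rule repeated_window_imp_periodic[OF e])
    fix q t :: nat assume q: "q < e" "window x (s + int t) n = window x (s + int q) n"
    have "window x (s + int q) n \<notin> L"
      using out[of "r + q"] q r by (simp add: s_def e_def add.assoc)
    then show "window x (s + int t) (Suc n) = window x (s + int q) (Suc n)"
      using det q by blast
  qed
  have "x (s + int (t + e)) = x (s + int t)" for t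
    using x_mod[of "t + e"] x_mod[of t] by simp
  then show False using aper eventually_periodic_half_lineI[OF e(1)] by blast
qed

text \<open>
  The reflection fixes no position: it exchanges the positions from \<open>0\<close> on with the negative ones,
  which are exactly the two halves in the definition of \<open>eventually_periodic_both\<close>.
\<close>

definition mirror :: "(int \<Rightarrow> 'a) \<Rightarrow> int \<Rightarrow> 'a" where
  "mirror x k = x (- 1 - k)"

lemma window_mirror: "window (mirror x) i n = rev (window x (- i - int n) n)"
  by (rule nth_equalityI) (auto simp: mirror_def rev_nth intro!: arg_cong[of _ _ x])

lemma subword_mirror: "subword w (mirror x) \<longleftrightarrow> subword (rev w) x"
proof -
  have "(\<exists>i. w = window (mirror x) i (length w)) \<longleftrightarrow> (\<exists>i. rev w = window x i (length w))"
    unfolding window_mirror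
    by (metis add_diff_cancel_right' minus_diff_eq rev_rev_ident)
  then show ?thesis by (simp add: subword_iff_window)
qed

lemma complexity_mirror: "complexity (mirror x) n = complexity x n"
proof -
  have "bij_betw rev {w. subword w (mirror x) \<and> length w = n} {w. subword w x \<and> length w = n}"
    by (rule bij_betw_byWitness[where f' = rev]) (auto simp: subword_mirror)
  then show ?thesis unfolding complexity_def by (rule bij_betw_same_card)
qed

text \<open>
  One of the two halves of \<open>x\<close> is not eventually periodic; if it is the left one, the reflected
  sequences satisfy the hypotheses of the one-sided statement.
\<close>

lemma periodic_words_syndetic:
  fixes d n :: nat
  assumes fin: "finite (range x)"
    and aper: "\<not> eventually_periodic_both x"
    and per: "\<And>k. p (k + int d) = p k" and d: "0 < d" "d < n"
    and px: "\<And>v. subword v p \<Longrightarrow> subword v x"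
    and slow: "complexity x (Suc n) \<le> complexity x n + 1"
    and v: "subword v x" "complexity x n + n \<le> length v"
  shows "\<exists>w. length w = n \<and> sublist w v \<and> subword w p"
proof (cases "eventually_periodic (\<lambda>k. x (int k))")
  case False
  then show ?thesis using periodic_words_syndetic_right[where p = p, OF fin False per d px slow v] by blast
next
  case True
  then have aper': "\<not> eventually_periodic (\<lambda>k. mirror x (int k))"
    using aper by (simp add: eventually_periodic_both_def mirror_def)
  have fin': "finite (range (mirror x))"
    by (rule finite_subset[OF _ fin]) (auto simp: mirror_def)
  have per': "mirror p (k + int d) = mirror p k" for k
    using per[of "- 1 - k - int d"] by (simp add: mirror_def algebra_simps)
  obtain w where "length w = n" "sublist w (rev v)" "subword w (mirror p)"
    using periodic_words_syndetic_right[where p = "mirror p", OF fin' aper' per' d, of "rev v"] px slow v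
    by (auto simp: subword_mirror complexity_mirror)
  then have "length (rev w) = n" "sublist (rev w) v" "subword (rev w) p"
    by (auto simp: subword_mirror sublist_rev_right)
  then show ?thesis by blast
qed

theorem theorem1p4:
  fixes A :: "'a set" and x :: "int \<Rightarrow> 'a"
  assumes "finite A"
    and "range x \<subseteq> A"
    and "\<not> uniformly_recurrent x"
    and "\<not> eventually_periodic_both x"
    and "liminf (\<lambda>n. ereal (real (complexity x n) - 2 * real n)) = - \<infinity>"
  shows "\<exists>(k::nat) M. periodic_orbit A M \<and>
    (\<forall>N::nat. \<exists>m>N. \<forall>v. subword v x \<and> length v = 3 * m + k \<longrightarrow>
       (\<exists>w. length w = m \<and> sublist w v \<and> (\<exists>p\<in>M. subword w p)))"
proof -
  have fin: "finite (range x)" using assms(1,2) finite_subset by blast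
  obtain w where w: "subword w x"
    and free: "\<And>N. N \<ge> 1 \<Longrightarrow> \<exists>v. subword v x \<and> length v = N \<and> \<not> sublist w v"
    using assms(3) unfolding uniformly_recurrent_def by blast
  obtain n where n: "length w \<le> n" "complexity x n + length w \<le> 2 * n"
    using small_deficit_frequently[OF assms(5), of "length w" "- int (length w)"] by auto
  obtain p and d :: nat where d: "d > 0" and per: "\<And>k. p (k + int d) = p k"
    and px: "\<And>v. subword v p \<Longrightarrow> subword v x"
    using periodic_sequence_in_orbit_closure[OF fin w free n] by metis
  define M where "M = {shift_pow n p |n. True}"
  have "range p \<subseteq> A"
  proof
    fix a assume "a \<in> range p"
    then obtain i where "a = p i" by blast
    then have "subword [a] p" by (auto simp: subword_def)
    then have "subword [a] x" by (rule px)
    then show "a \<in> A" using assms(2) by (auto simp: subword_def)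
  qed
  moreover have "periodic p"
    unfolding periodic_def using d per by (intro exI[of _ "int d"]) auto
  ultimately have "periodic_orbit A M" unfolding periodic_orbit_def M_def by blast
  moreover have "p \<in> M"
    unfolding M_def by (rule CollectI, rule exI[of _ 0]) (simp add: shift_pow_def)
  then have "\<exists>m>N. \<forall>v. subword v x \<and> length v = 3 * m + 0 \<longrightarrow>
       (\<exists>w. length w = m \<and> sublist w v \<and> (\<exists>p\<in>M. subword w p))" for N
  proof -
    obtain m where m: "m \<ge> Suc (N + d)" "complexity x m \<le> 2 * m"
        "complexity x (Suc m) \<le> complexity x m + 1"
      using slow_growth_frequently[OF complexity_mono_Suc[OF fin] assms(5)] by blast
    have "\<exists>w. length w = m \<and> sublist w v \<and> (\<exists>p\<in>M. subword w p)"
      if v: "subword v x" "length v = 3 * m" for v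
    proof -
      have "\<exists>w. length w = m \<and> sublist w v \<and> subword w p"
        using m v by (intro periodic_words_syndetic[where p = p, OF fin assms(4) per d _ px]) auto
      then show ?thesis using \<open>p \<in> M\<close> by blast
    qed
    then show ?thesis using m(1) by (intro exI[of _ m]) auto
  qed
  ultimately show ?thesis by blast
qed

end
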